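(* Suppose that $\{\epsilon^k\}$ is a sequence of (componentwise) non-increasing positive vectors in $\mathbb{R}^n$ and $\epsilon^k\to0$ as $k\to\infty$. Let the sequence $\{x^k\}$ be generated by the variant of the second type of $\mathrm{IRL}_\alpha$ minimization method (described in the context) using $\{\epsilon^k\}$. Suppose that $x^*$ is an accumulation point of $\{x^k\}$. Then $x^*$ is a stationary point of $\min_{x\in\mathbb{R}^n}\{F(x)=f(x)+\lambda\|x\|_p^p\}$, i.e., $x^*_i\,\partial f(x^* )/\partial x_i+\lambda p|x^*_i|^p=0$ for all $i$.
   Context: Here $\lambda>0$, $p\in(0,1)$, $\alpha\ge1$, and $f:\mathbb{R}^n\to\mathbb{R}$ is continuously differentiable, bounded below, with $L_f$-Lipschitz continuous gradient: $\|\nabla f(x)-\nabla f(y)\|_2\le L_f\|x-y\|_2$ for all $x,y$. $\|x\|_p^p=\sum_i|x_i|^p$. For a positive vector $\epsilon\in\mathbb{R}^n$, $F_{\alpha,\epsilon}(x):=f(x)+\lambda\sum_{i=1}^n(|x_i|^\alpha+\epsilon_i)^{p/\alpha}$. The variant of the second type of $\mathrm{IRL}_\alpha$ method: let $0<L_{\min}<L_{\max}$, $\tau>1$, $c>0$ be given and choose an arbitrary $x^0$. For $k=0,1,2,\dots$: choose $L^0_k\in[L_{\min},L_{\max}]$ arbitrarily and set $L_k=L^0_k$; then (1a) compute $$x^{k+1}\in\mathrm{Arg\,min}_x\left\{f(x^k)+\nabla f(x^k)^T(x-x^k)+\frac{L_k}{2}\|x-x^k\|_2^2+\frac{\lambda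 p}{\alpha}\sum_{i=1}^n s^k_i|x_i|^\alpha\right\},\quad s^k_i=(|x^k_i|^\alpha+\epsilon^k_i)^{\frac p\alpha-1};$$ (1b) if $F_{\alpha,\epsilon^k}(x^k)-F_{\alpha,\epsilon^{k+1}}(x^{k+1})\ge\frac c2\|x^{k+1}-x^k\|_2^2$, accept $x^{k+1}$ and go to the next $k$; (1c) otherwise set $L_k\leftarrow\tau L_k$ and return to (1a). *)

theory Defs
  imports "HOL-Analysis.Analysis"
begin

definition partial_deriv :: "(real ^ 'n \<Rightarrow> real) \<Rightarrow> 'n::finite \<Rightarrow> real ^ 'n \<Rightarrow> real" where
  "partial_deriv f i x = frechet_derivative f (at x) (axis i 1)"

definition gradient :: "(real ^ 'n::finite \<Rightarrow> real) \<Rightarrow> real ^ 'n \<Rightarrow> real ^ 'n" where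
  "gradient f x = (\<chi> i. partial_deriv f i x)"

lemma GDERIV_gradient:
  fixes f :: "real ^ 'n::finite \<Rightarrow> real"
  assumes "f differentiable (at x)"
  shows "GDERIV f x :> gradient f x"
proof -
  have D: "(f has_derivative frechet_derivative f (at x)) (at x)"
    using assms frechet_derivative_works by blast
  then interpret linear "frechet_derivative f (at x)"
    by (rule has_derivative_linear)
  have "frechet_derivative f (at x) h = h \<bullet> gradient f x" for h
  proof -
    have "frechet_derivative f (at x) h
        = frechet_derivative f (at x) (\<Sum>i\<in>UNIV. h $ i *\<^sub>R axis i 1)"
      using basis_expansion[of h] by (simp add: scalar_mult_eq_scaleR)
    also have "\<dots> = (\<Sum>i\<in>UNIV. h $ i * frechet_derivative f (at x) (axis i 1))"
      by (simp add: sum scale)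
    finally show ?thesis
      by (simp add: inner_vec_def gradient_def partial_deriv_def)
  qed
  then have "frechet_derivative f (at x) = (\<lambda>h. h \<bullet> gradient f x)"
    by blast
  then show ?thesis
    using D by (simp add: gderiv_def)
qed

text \<open>
  Real powers are written with \<^term>\<open>(powr)\<close>. Its convention that \<^prop>\<open>0 powr (a::real) = 0\<close>
  agrees with the usual power here: a zero base only occurs below with exponent
  \<^prop>\<open>(alpha::real) \<ge> 1\<close> or \<^prop>\<open>(p::real) > 0\<close>.
\<close>

text \<open>First-order stationary points of \<open>F(x) = f(x) + lam * (\<Sum>i. \<bar>x\<^sub>i\<bar> powr p)\<close> for \<open>0 < p < 1\<close>.
  As \<open>F\<close> is not differentiable in the directions of the vanishing coordinates, stationarity is
  defined by \<open>x\<^sub>i * \<partial>F/\<partial>x\<^sub>i = 0\<close>, multiplied out so that it makes sense for every \<open>x\<^sub>i\<close>.\<close>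
definition lp_stationary_point ::
    "(real ^ 'n::finite \<Rightarrow> real) \<Rightarrow> real \<Rightarrow> real \<Rightarrow> real ^ 'n \<Rightarrow> bool" where
  "lp_stationary_point f lam p x \<longleftrightarrow>
     (\<forall>i. x $ i * partial_deriv f i x + lam * p * \<bar>x $ i\<bar> powr p = 0)"

definition F_smooth ::
    "(real ^ 'n::finite \<Rightarrow> real) \<Rightarrow> real \<Rightarrow> real \<Rightarrow> real \<Rightarrow> real ^ 'n \<Rightarrow> real ^ 'n \<Rightarrow> real" where
  "F_smooth f lam p alpha eps x =
     f x + lam * (\<Sum>i\<in>UNIV. (\<bar>x $ i\<bar> powr alpha + eps $ i) powr (p / alpha))"

definition irl_weight ::
    "real \<Rightarrow> real \<Rightarrow> real ^ 'n::finite \<Rightarrow> real ^ 'n \<Rightarrow> 'n \<Rightarrow> real" where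
  "irl_weight p alpha eps u i = (\<bar>u $ i\<bar> powr alpha + eps $ i) powr (p / alpha - 1)"

definition irl_model ::
    "(real ^ 'n::finite \<Rightarrow> real) \<Rightarrow> real \<Rightarrow> real \<Rightarrow> real \<Rightarrow> real ^ 'n \<Rightarrow> real \<Rightarrow> real ^ 'n \<Rightarrow> real ^ 'n \<Rightarrow> real"
  where
  "irl_model f lam p alpha eps L u x =
     f u + gradient f u \<bullet> (x - u) + L / 2 * (norm (x - u))\<^sup>2
     + lam * p / alpha * (\<Sum>i\<in>UNIV. irl_weight p alpha eps u i * \<bar>x $ i\<bar> powr alpha)"

definition irl_accept ::
    "(real ^ 'n::finite \<Rightarrow> real) \<Rightarrow> real \<Rightarrow> real \<Rightarrow> real \<Rightarrow> real \<Rightarrow> real ^ 'n \<Rightarrow> real ^ 'n \<Rightarrow> real ^ 'n \<Rightarrow> real ^ 'n \<Rightarrow> bool"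
  where
  "irl_accept f lam p alpha c eps eps' u y \<longleftrightarrow>
     F_smooth f lam p alpha eps u - F_smooth f lam p alpha eps' y \<ge> c / 2 * (norm (y - u))\<^sup>2"

text \<open>In outer iteration \<open>k\<close>, \<open>y j\<close> is the trial point computed with \<open>L\<^sub>k = tau ^ j * L0\<close>; the first
  \<open>J\<close> trial points are rejected and \<open>y J\<close> is accepted.\<close>
definition irl2_variant_sequence ::
    "(real ^ 'n::finite \<Rightarrow> real) \<Rightarrow> real \<Rightarrow> real \<Rightarrow> real \<Rightarrow> real \<Rightarrow> real \<Rightarrow> real \<Rightarrow> real
     \<Rightarrow> (nat \<Rightarrow> real ^ 'n) \<Rightarrow> (nat \<Rightarrow> real ^ 'n) \<Rightarrow> bool" where
  "irl2_variant_sequence f lam p alpha Lmin Lmax tau c eps x \<longleftrightarrow>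
     (\<forall>k. \<exists>L0\<in>{Lmin..Lmax}. \<exists>J::nat. \<exists>y::nat \<Rightarrow> real ^ 'n.
        (\<forall>j\<le>J. is_arg_min (irl_model f lam p alpha (eps k) (tau ^ j * L0) (x k)) (\<lambda>_. True) (y j)) \<and>
        (\<forall>j<J. \<not> irl_accept f lam p alpha c (eps k) (eps (Suc k)) (x k) (y j)) \<and>
        irl_accept f lam p alpha c (eps k) (eps (Suc k)) (x k) (y J) \<and>
        x (Suc k) = y J)"

end

theory Submission
  imports Defs
begin

text \<open>
  Concavity of \<open>t powr (p / alpha)\<close> makes \<^const>\<open>irl_model\<close> a majorant of the smoothed objective
  up to a constant as soon as \<open>L \<ge> Lf\<close>, so every trial point with \<open>L \<ge> Lf + c\<close> is accepted and
  the accepted \<open>L\<^sub>k\<close> stay bounded. The smoothed objective values decrease and are bounded below,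
  hence \<open>x\<^sup>k\<^sup>+\<^sup>1 - x\<^sup>k\<close> tends to zero. Scaling the \<open>i\<close>-th coordinate of a minimiser of the model by a
  factor near 1 yields a first-order condition that has no kink at zero, and this condition passes
  to the limit: at a vanishing coordinate of \<open>xs\<close> stationarity is trivial, at all others the
  weights converge.
\<close>

text \<open>Young's inequality with weights \<open>q\<close> and \<open>1 - q\<close> bounds
  \<open>t powr q * s powr (1 - q)\<close> by \<open>q * t + (1 - q) * s\<close>, which is
  \<open>s + q * (t - s)\<close>. Multiplying by \<open>s powr (q - 1)\<close> gives the tangent at
  \<open>s\<close>.\<close>

lemma powr_le_tangent:
  fixes q s t :: real
  assumes "0 \<le> q" "q \<le> 1" "s > 0" "t > 0"
  shows "t powr q \<le> s powr q + q * s powr (q - 1) * (t - s)"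
proof -
  have e1: "s powr (1 - q) * s powr (q - 1) = 1"
    using assms by (simp flip: powr_add)
  have e2: "s * s powr (q - 1) = s powr q"
    using assms by (simp add: powr_diff)
  have "t powr q * s powr (1 - q) \<le> q * t + (1 - q) * s"
    by (rule Youngs_inequality_0) (use assms in auto)
  then have "t powr q * s powr (1 - q) * s powr (q - 1) \<le> (q * t + (1 - q) * s) * s powr (q - 1)"
    by (rule mult_right_mono) simp
  then have "t powr q * (s powr (1 - q) * s powr (q - 1))
      \<le> s * s powr (q - 1) + q * s powr (q - 1) * (t - s)"
    by (simp add: algebra_simps)
  then show ?thesis
    by (simp only: e1 e2 mult_1_right)
qed

text \<open>The descent lemma, proved without integration: along the segment from \<open>u\<close>
  to \<open>y\<close>, the gap between \<open>f\<close> and the quadratic bound has a nonpositive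
  derivative by Cauchy-Schwarz and the Lipschitz condition.\<close>

lemma Lipschitz_gradient_upper_bound:
  fixes f :: "real ^ 'n::finite \<Rightarrow> real"
  assumes diff: "\<And>u. f differentiable (at u)"
    and lip: "\<And>u v. norm (gradient f u - gradient f v) \<le> Lf * norm (u - v)"
  shows "f y \<le> f u + gradient f u \<bullet> (y - u) + Lf / 2 * (norm (y - u))\<^sup>2"
proof -
  define d where "d = y - u"
  \<comment> \<open>Up to the constant \<open>f u\<close>, \<open>h\<close> is the gap at
    \<open>u + t *\<^sub>R d\<close>; the claim is exactly \<open>h 1 \<le> h 0\<close>.\<close>
  define h where "h t = f (u + t *\<^sub>R d) - t * (gradient f u \<bullet> d) - Lf / 2 * t\<^sup>2 * (norm d)\<^sup>2" for t
  define h' where "h' t = (gradient f (u + t *\<^sub>R d) - gradient f u) \<bullet> d - Lf * t * (norm d)\<^sup>2" for t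
  have deriv: "(h has_real_derivative h' t) (at t)" for t
  proof -
    have "(f has_derivative (\<lambda>h. h \<bullet> gradient f (u + t *\<^sub>R d))) (at (u + t *\<^sub>R d))"
      using GDERIV_gradient[OF diff] by (simp add: gderiv_def)
    then have "((\<lambda>t. f (u + t *\<^sub>R d)) has_derivative (\<lambda>s. (s *\<^sub>R d) \<bullet> gradient f (u + t *\<^sub>R d))) (at t)"
      by (rule has_derivative_compose[rotated]) (auto intro!: derivative_eq_intros)
    then have "((\<lambda>t. f (u + t *\<^sub>R d)) has_real_derivative gradient f (u + t *\<^sub>R d) \<bullet> d) (at t)"
      by (simp add: has_field_derivative_def inner_commute mult_commute_abs)
    then show ?thesis
      unfolding h_def h'_def
      by (auto intro!: derivative_eq_intros simp: inner_diff_left)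
  qed
  have nonpos: "h' t \<le> 0" if "0 \<le> t" for t
  proof -
    have "(gradient f (u + t *\<^sub>R d) - gradient f u) \<bullet> d
        \<le> norm (gradient f (u + t *\<^sub>R d) - gradient f u) * norm d"
      by (rule norm_cauchy_schwarz)
    also have "\<dots> \<le> (Lf * norm (u + t *\<^sub>R d - u)) * norm d"
      by (intro mult_right_mono lip) simp
    also have "\<dots> = Lf * t * (norm d)\<^sup>2"
      using that by (simp add: power2_eq_square)
    finally show ?thesis by (simp add: h'_def)
  qed
  have "h 1 \<le> h 0"
    by (rule DERIV_nonpos_imp_nonincreasing) (use deriv nonpos in auto)
  then show ?thesis by (simp add: h_def d_def)
qed

lemma irl_accept_of_large_curvature:
  fixes f :: "real ^ 'n::finite \<Rightarrow> real"
  assumes par: "lam > 0" "0 < p" "p < 1" "alpha \<ge> 1"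
    and diff: "\<And>u. f differentiable (at u)"
    and lip: "\<And>u v. norm (gradient f u - gradient f v) \<le> Lf * norm (u - v)"
    and eps: "\<And>i. 0 < eps' $ i" "\<And>i. eps' $ i \<le> eps $ i"
    and L: "L \<ge> Lf + c"
    and min: "is_arg_min (irl_model f lam p alpha eps L u) (\<lambda>_. True) y"
  shows "irl_accept f lam p alpha c eps eps' u y"
proof -
  define q where "q = p / alpha"
  have q: "0 < q" "q < 1" using par by (auto simp: q_def)
  define S where "S v = (\<Sum>i\<in>UNIV. (\<bar>v $ i\<bar> powr alpha + eps $ i) powr q)" for v :: "real ^ 'n"
  define W where "W v = (\<Sum>i\<in>UNIV. irl_weight p alpha eps u i * \<bar>v $ i\<bar> powr alpha)" for v :: "real ^ 'n"
  define N where "N = (norm (y - u))\<^sup>2"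
  have pos: "eps $ i > 0" for i using eps[of i] by linarith
  have "S y \<le> (\<Sum>i\<in>UNIV. (\<bar>u $ i\<bar> powr alpha + eps $ i) powr q
      + q * irl_weight p alpha eps u i * (\<bar>y $ i\<bar> powr alpha - \<bar>u $ i\<bar> powr alpha))"
    unfolding S_def
  proof (rule sum_mono)
    fix i
    have "\<bar>u $ i\<bar> powr alpha + eps $ i > 0" "\<bar>y $ i\<bar> powr alpha + eps $ i > 0"
      using pos by (simp_all add: add_nonneg_pos)
    from powr_le_tangent[OF _ _ this, of q]
    show "(\<bar>y $ i\<bar> powr alpha + eps $ i) powr q \<le> (\<bar>u $ i\<bar> powr alpha + eps $ i) powr q
      + q * irl_weight p alpha eps u i * (\<bar>y $ i\<bar> powr alpha - \<bar>u $ i\<bar> powr alpha)"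
      using q by (simp add: irl_weight_def q_def)
  qed
  also have "\<dots> = S u + q * (W y - W u)"
    unfolding S_def W_def
    by (simp add: sum.distrib sum_subtractf sum_distrib_left algebra_simps)
  finally have "lam * S y \<le> lam * (S u + q * (W y - W u))"
    using par by (intro mult_left_mono) auto
  then have S: "lam * S y \<le> lam * S u + lam * q * W y - lam * q * W u"
    by (simp add: algebra_simps)
  \<comment> \<open>The minimiser is compared with the current iterate \<open>u\<close>, where the
    linear and quadratic terms vanish.\<close>
  have "irl_model f lam p alpha eps L u y \<le> irl_model f lam p alpha eps L u u"
    using min by (auto simp: is_arg_min_def not_less)
  then have M: "gradient f u \<bullet> (y - u) + L / 2 * N + lam * q * W y \<le> lam * q * W u"
    by (simp add: irl_model_def W_def N_def q_def)
  have D: "f y \<le> f u + gradient f u \<bullet> (y - u) + Lf / 2 * N"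
    unfolding N_def by (rule Lipschitz_gradient_upper_bound[OF diff lip])
  \<comment> \<open>Replacing \<open>eps\<close> by the smaller \<open>eps'\<close> can only lower
    the smoothed penalty, since \<open>q > 0\<close>.\<close>
  have "(\<Sum>i\<in>UNIV. (\<bar>y $ i\<bar> powr alpha + eps' $ i) powr q) \<le> S y"
    unfolding S_def using eps q
    by (intro sum_mono powr_mono2) (auto intro: add_nonneg_nonneg less_imp_le[OF eps(1)])
  then have E: "F_smooth f lam p alpha eps' y \<le> f y + lam * S y"
    using par by (simp add: F_smooth_def q_def)
  \<comment> \<open>The model has curvature \<open>L\<close> while the descent lemma uses only
    \<open>Lf\<close>; the surplus of at least \<open>c\<close> pays for the required
    decrease.\<close>
  have "(Lf + c) * N \<le> L * N"
    using L by (intro mult_right_mono) (auto simp: N_def)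
  then have C: "c / 2 * N \<le> L / 2 * N - Lf / 2 * N"
    by (simp add: algebra_simps)
  have "F_smooth f lam p alpha eps u = f u + lam * S u"
    by (simp add: F_smooth_def S_def q_def)
  then show ?thesis
    unfolding irl_accept_def N_def[symmetric] using S M D E C by linarith
qed

text \<open>The coordinate \<open>y $ i\<close> is replaced by \<open>t * y $ i\<close>. For
  \<open>t > 0\<close> the penalty term becomes
  \<open>t powr alpha * \<bar>y $ i\<bar> powr alpha\<close>, which is differentiable at
  \<open>t = 1\<close> even if \<open>y $ i = 0\<close> and \<open>alpha = 1\<close>. The inner
  derivative supplies the factor \<open>y $ i\<close> that also appears in the stationarity
  condition.\<close>

lemma irl_model_arg_min_first_order:
  fixes f :: "real ^ 'n::finite \<Rightarrow> real"
  assumes alpha: "alpha \<ge> 1"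
    and min: "is_arg_min (irl_model f lam p alpha eps L u) (\<lambda>_. True) y"
  shows "y $ i * (gradient f u $ i + L * (y $ i - u $ i))
    + lam * p * irl_weight p alpha eps u i * \<bar>y $ i\<bar> powr alpha = 0"
proof -
  define w where "w = irl_weight p alpha eps u"
  define v where "v t = y + ((t - 1) * y $ i) *\<^sub>R axis i 1" for t :: real
  define C where "C = f u + gradient f u \<bullet> (y - u) + L / 2 * (norm (y - u))\<^sup>2
    + lam * p / alpha * (\<Sum>j\<in>UNIV - {i}. w j * \<bar>y $ j\<bar> powr alpha)"
  \<comment> \<open>The model along \<open>v\<close>, with all terms independent of \<open>t\<close>
    collected in \<open>C\<close>.\<close>
  define \<phi> where "\<phi> t = C + (t - 1) * y $ i * gradient f u $ i
    + L / 2 * (2 * ((t - 1) * y $ i) * (y $ i - u $ i) + ((t - 1) * y $ i)\<^sup>2)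
    + lam * p / alpha * (w i * (t powr alpha * \<bar>y $ i\<bar> powr alpha))" for t
  have model: "irl_model f lam p alpha eps L u (v t) = \<phi> t" if "t > 0" for t
  proof -
    have vi: "v t $ i = t * y $ i"
      by (simp add: v_def algebra_simps)
    have vj: "v t $ j = y $ j" if "j \<noteq> i" for j
      using that by (simp add: v_def axis_def)
    have "(\<Sum>j\<in>UNIV. w j * \<bar>v t $ j\<bar> powr alpha)
        = w i * \<bar>v t $ i\<bar> powr alpha + (\<Sum>j\<in>UNIV - {i}. w j * \<bar>v t $ j\<bar> powr alpha)"
      by (rule sum.remove) auto
    also have "(\<Sum>j\<in>UNIV - {i}. w j * \<bar>v t $ j\<bar> powr alpha)
        = (\<Sum>j\<in>UNIV - {i}. w j * \<bar>y $ j\<bar> powr alpha)"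
      by (rule sum.cong) (auto simp: vj)
    also have "\<bar>v t $ i\<bar> powr alpha = t powr alpha * \<bar>y $ i\<bar> powr alpha"
      using that by (simp add: vi abs_mult powr_mult)
    finally have S: "(\<Sum>j\<in>UNIV. w j * \<bar>v t $ j\<bar> powr alpha)
      = w i * (t powr alpha * \<bar>y $ i\<bar> powr alpha) + (\<Sum>j\<in>UNIV - {i}. w j * \<bar>y $ j\<bar> powr alpha)" .
    define z where "z = (t - 1) * y $ i"
    have vu: "v t - u = (y - u) + z *\<^sub>R axis i 1"
      by (simp add: v_def z_def)
    have G: "gradient f u \<bullet> (v t - u) = gradient f u \<bullet> (y - u) + z * gradient f u $ i"
      unfolding vu by (simp add: inner_add_right inner_axis)
    have Q: "(norm (v t - u))\<^sup>2 = (norm (y - u))\<^sup>2 + (2 * z * (y $ i - u $ i) + z\<^sup>2)"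
      unfolding vu power2_norm_eq_inner
      by (simp add: inner_add_left inner_add_right inner_axis inner_axis' power2_eq_square
          algebra_simps)
    show ?thesis
      unfolding irl_model_def w_def[symmetric] S G Q \<phi>_def C_def z_def
      by (simp add: algebra_simps)
  qed
  \<comment> \<open>Radius 1 around \<open>t = 1\<close> keeps \<open>t\<close> positive, where
    \<open>\<phi>\<close> agrees with the model.\<close>
  have "\<phi> 1 \<le> \<phi> t" if "\<bar>1 - t\<bar> < 1" for t
  proof -
    have "irl_model f lam p alpha eps L u (v 1) \<le> irl_model f lam p alpha eps L u (v t)"
      using min by (auto simp: is_arg_min_def not_less v_def)
    then show ?thesis using that by (simp add: model)
  qed
  moreover have "(\<phi> has_real_derivative y $ i * (gradient f u $ i + L * (y $ i - u $ i))
      + lam * p / alpha * (w i * (alpha * \<bar>y $ i\<bar> powr alpha))) (at 1)"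
    unfolding \<phi>_def
    by (auto intro!: derivative_eq_intros simp: algebra_simps)
  ultimately have "y $ i * (gradient f u $ i + L * (y $ i - u $ i))
      + lam * p / alpha * (w i * (alpha * \<bar>y $ i\<bar> powr alpha)) = 0"
    by (intro DERIV_local_min[where d = 1 and x = 1]) auto
  then show ?thesis using alpha by (simp add: w_def)
qed

theorem theorem3p8:
  fixes f :: "real ^ 'n::finite \<Rightarrow> real"
    and lam p alpha Lf Lmin Lmax tau c :: real
    and eps x :: "nat \<Rightarrow> real ^ 'n"
    and xs :: "real ^ 'n"
  assumes "lam > 0" and "0 < p" and "p < 1" and "alpha \<ge> 1"
    and "\<And>u. f differentiable (at u)"
    and "continuous_on UNIV (gradient f)"
    and "bdd_below (range f)"
    and "\<And>u v. norm (gradient f u - gradient f v) \<le> Lf * norm (u - v)"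
    and "0 < Lmin" and "Lmin < Lmax" and "tau > 1" and "c > 0"
    and "\<And>k i. eps k $ i > 0"
    and "\<And>i. decseq (\<lambda>k. eps k $ i)"
    and "eps \<longlonglongrightarrow> 0"
    and "irl2_variant_sequence f lam p alpha Lmin Lmax tau c eps x"
    and "\<exists>r :: nat \<Rightarrow> nat. strict_mono r \<and> (x \<circ> r) \<longlonglongrightarrow> xs"
  shows "lp_stationary_point f lam p xs"
proof -
  \<comment> \<open>Either the first trial is accepted with \<open>L0 \<le> Lmax\<close>, or the
    accepted value is \<open>tau\<close> times a rejected one, which cannot exceed
    \<open>Lf + c\<close>.\<close>
  define Lbar where "Lbar = max Lmax (tau * (Lf + c))"
  have "\<exists>L. 0 \<le> L \<and> L \<le> Lbar
      \<and> is_arg_min (irl_model f lam p alpha (eps k) L (x k)) (\<lambda>_. True) (x (Suc k))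
      \<and> irl_accept f lam p alpha c (eps k) (eps (Suc k)) (x k) (x (Suc k))" for k
  proof -
    from assms(16) obtain L0 J y where L0: "L0 \<in> {Lmin..Lmax}"
      and mins: "\<And>j. j \<le> J \<Longrightarrow>
        is_arg_min (irl_model f lam p alpha (eps k) (tau ^ j * L0) (x k)) (\<lambda>_. True) (y j)"
      and rej: "\<And>j. j < J \<Longrightarrow> \<not> irl_accept f lam p alpha c (eps k) (eps (Suc k)) (x k) (y j)"
      and acc: "irl_accept f lam p alpha c (eps k) (eps (Suc k)) (x k) (y J)"
      and y: "x (Suc k) = y J"
      unfolding irl2_variant_sequence_def by blast
    have "tau ^ J * L0 \<le> Lbar"
    proof (cases J)
      case 0
      then show ?thesis using L0 by (simp add: Lbar_def le_max_iff_disj)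
    next
      \<comment> \<open>Here \<open>j\<close> is the index of the last rejected trial.\<close>
      case (Suc j)
      have "eps (Suc k) $ i \<le> eps k $ i" for i
        using assms(14)[of i] by (simp add: decseq_Suc_iff)
      then have "tau ^ j * L0 \<le> Lf + c"
        using irl_accept_of_large_curvature[OF assms(1-5,8,13), of "Suc k" "eps k" c "tau ^ j * L0" "x k" "y j"]
          mins[of j] rej[of j] Suc
        by (metis lessI less_imp_le linear)
      then have "tau * (tau ^ j * L0) \<le> tau * (Lf + c)"
        using assms(11) by (intro mult_left_mono) auto
      then show ?thesis using Suc by (simp add: Lbar_def mult.assoc)
    qed
    moreover have "0 \<le> tau ^ J * L0"
      using L0 assms(9,11) by auto
    ultimately show ?thesis using mins[of J] acc y by auto
  qed
  then obtain L where L: "\<And>k. 0 \<le> L k" "\<And>k. L k \<le> Lbar"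
    and min: "\<And>k. is_arg_min (irl_model f lam p alpha (eps k) (L k) (x k)) (\<lambda>_. True) (x (Suc k))"
    and acc: "\<And>k. irl_accept f lam p alpha c (eps k) (eps (Suc k)) (x k) (x (Suc k))"
    by metis
  \<comment> \<open>Each iterate is measured with its own smoothing vector, so the acceptance test
    bounds the step by a difference of consecutive terms of \<open>a\<close>.\<close>
  define a where "a k = F_smooth f lam p alpha (eps k) (x k)" for k
  have step: "c / 2 * (norm (x (Suc k) - x k))\<^sup>2 \<le> a k - a (Suc k)" for k
    using acc[of k] by (simp add: irl_accept_def a_def)
  obtain m where m: "\<And>u. m \<le> f u"
    using assms(7) by (auto simp: bdd_below_def)
  have "m \<le> a k" for k
  proof -
    have "0 \<le> lam * (\<Sum>i\<in>UNIV. (\<bar>x k $ i\<bar> powr alpha + eps k $ i) powr (p / alpha))"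
      using assms(1) by (intro mult_nonneg_nonneg sum_nonneg) auto
    then show ?thesis using m[of "x k"] by (simp add: a_def F_smooth_def)
  qed
  moreover have "decseq a"
  proof (rule decseq_SucI)
    fix k
    have "0 \<le> c / 2 * (norm (x (Suc k) - x k))\<^sup>2" using assms(12) by simp
    then show "a (Suc k) \<le> a k" using step[of k] by linarith
  qed
  ultimately obtain l where l: "a \<longlonglongrightarrow> l"
    using decseq_convergent[of a m] by blast
  have "(\<lambda>k. 2 / c * (a k - a (Suc k))) \<longlonglongrightarrow> 2 / c * (l - l)"
    by (intro tendsto_intros l LIMSEQ_Suc)
  then have "(\<lambda>k. 2 / c * (a k - a (Suc k))) \<longlonglongrightarrow> 0" by simp
  then have "(\<lambda>k. (norm (x (Suc k) - x k))\<^sup>2) \<longlonglongrightarrow> 0"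
  proof (rule tendsto_sandwich[rotated 3, OF _ ])
    show "\<forall>\<^sub>F k in sequentially. (norm (x (Suc k) - x k))\<^sup>2 \<le> 2 / c * (a k - a (Suc k))"
      using step assms(12) by (intro always_eventually allI) (simp add: field_simps)
  qed auto
  then have "(\<lambda>k. norm (x (Suc k) - x k)) \<longlonglongrightarrow> 0"
    by simp
  then have dx: "(\<lambda>k. x (Suc k) - x k) \<longlonglongrightarrow> 0"
    by (rule tendsto_norm_zero_cancel)
  obtain r where r: "strict_mono r" and xr: "(\<lambda>n. x (r n)) \<longlonglongrightarrow> xs"
    using assms(17) by (auto simp: o_def)
  have dxr: "(\<lambda>n. x (Suc (r n)) - x (r n)) \<longlonglongrightarrow> 0"
    using LIMSEQ_subseq_LIMSEQ[OF dx r] by (simp add: o_def)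
  have yr: "(\<lambda>n. x (Suc (r n))) \<longlonglongrightarrow> xs"
    using tendsto_add[OF dxr xr] by simp
  have epsr: "(\<lambda>n. eps (r n)) \<longlonglongrightarrow> 0"
    using LIMSEQ_subseq_LIMSEQ[OF assms(15) r] by (simp add: o_def)
  have gr: "(\<lambda>n. gradient f (x (r n))) \<longlonglongrightarrow> gradient f xs"
    by (rule continuous_on_tendsto_compose[OF assms(6) xr]) auto
  \<comment> \<open>Boundedness of the accepted \<open>L k\<close> is what makes the proximal term
    vanish in the limit.\<close>
  have Lr: "(\<lambda>n. L (r n) * (x (Suc (r n)) $ i - x (r n) $ i)) \<longlonglongrightarrow> 0" for i
  proof (rule tendsto_0_le[where K = Lbar])
    show "(\<lambda>n. x (Suc (r n)) $ i - x (r n) $ i) \<longlonglongrightarrow> 0"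
      using tendsto_vec_nth[OF dxr, of i] by simp
    show "\<forall>\<^sub>F n in sequentially. norm (L (r n) * (x (Suc (r n)) $ i - x (r n) $ i))
        \<le> norm (x (Suc (r n)) $ i - x (r n) $ i) * Lbar"
      using L by (intro always_eventually allI)
        (simp add: abs_mult mult.commute[of _ Lbar] mult_right_mono)
  qed
  have "xs $ i * partial_deriv f i xs + lam * p * \<bar>xs $ i\<bar> powr p = 0" for i
  proof (cases "xs $ i = 0")
    case True
    then show ?thesis by simp
  next
    case False
    \<comment> \<open>Since \<open>xs $ i\<close> is nonzero, the limit of the base is positive, so
      the negative exponent \<open>p / alpha - 1\<close> causes no blow-up of the weights.\<close>
    have base: "(\<lambda>n. \<bar>x (r n) $ i\<bar> powr alpha + eps (r n) $ i) \<longlonglongrightarrow> \<bar>xs $ i\<bar> powr alpha + 0 $ i"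
      using False by (intro tendsto_intros xr epsr) auto
    have weight: "(\<lambda>n. irl_weight p alpha (eps (r n)) (x (r n)) i)
        \<longlonglongrightarrow> (\<bar>xs $ i\<bar> powr alpha + 0 $ i) powr (p / alpha - 1)"
      unfolding irl_weight_def using False by (intro tendsto_powr base tendsto_const) auto
    \<comment> \<open>The first-order condition mixes the old iterate (gradient and weight) with the
      new one; both tend to \<open>xs\<close> along \<open>r\<close>.\<close>
    have "(\<lambda>n. x (Suc (r n)) $ i * (gradient f (x (r n)) $ i
          + L (r n) * (x (Suc (r n)) $ i - x (r n) $ i))
        + lam * p * irl_weight p alpha (eps (r n)) (x (r n)) i * \<bar>x (Suc (r n)) $ i\<bar> powr alpha)
      \<longlonglongrightarrow> xs $ i * (gradient f xs $ i + 0)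
        + lam * p * (\<bar>xs $ i\<bar> powr alpha + 0 $ i) powr (p / alpha - 1) * \<bar>xs $ i\<bar> powr alpha"
      using False by (intro tendsto_intros yr gr Lr weight) auto
    then have "xs $ i * (gradient f xs $ i + 0)
        + lam * p * (\<bar>xs $ i\<bar> powr alpha + 0 $ i) powr (p / alpha - 1) * \<bar>xs $ i\<bar> powr alpha = 0"
      \<comment> \<open>By the first-order condition every term of the sequence is 0, and hence so
        is its limit.\<close>
      unfolding irl_model_arg_min_first_order[OF assms(4) min]
      by (simp only: LIMSEQ_const_iff)
    moreover have "(\<bar>xs $ i\<bar> powr alpha) powr (p / alpha - 1) * \<bar>xs $ i\<bar> powr alpha = \<bar>xs $ i\<bar> powr p"
    proof -
      have "alpha * (p / alpha - 1) + alpha = p"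
        using assms(4) by (simp add: field_simps)
      then show ?thesis by (simp add: powr_powr flip: powr_add)
    qed
    ultimately show ?thesis
      by (simp add: gradient_def mult.assoc)
  qed
  then show ?thesis by (simp add: lp_stationary_point_def)
qed

end
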